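(* Let $G$ be a micro-associative paratopological gyrogroup. If $G$ is regular, then $G$ is completely regular. If $G$ is Hausdorff, then $G$ is functionally Hausdorff.
   Context: A gyrogroup is a nonempty set $G$ with a binary operation $\oplus$ such that: (G1) there is $e\in G$ with $e\oplus x=x=x\oplus e$ for all $x$; (G2) each $x\in G$ has an inverse $\ominus x$ with $\ominus x\oplus x=e=x\oplus(\ominus x)$; (G3) for all $x,y\in G$ there is an automorphism $\mathrm{gyr}[x,y]$ of the groupoid $(G,\oplus)$ (a bijection of $G$ preserving $\oplus$) with $x\oplus(y\oplus z)=(x\oplus y)\oplus \mathrm{gyr}[x,y](z)$ for all $z\in G$; (G4) $\mathrm{gyr}[x\oplus y,y]=\mathrm{gyr}[x,y]$ for all $x,y\in G$. A paratopological gyrogroup is a gyrogroup $G$ with a topology such that $\oplus:G\times G\to G$ is (jointly) continuous, where $G\times G$ carries the product topology. For $x\in G$, $A\subseteq G$, $x\oplus A=\{x\oplus a:a\in A\}$. A paratopological gyrogroup $G$ is micro-associative if for every neighborhood $U\subseteq G$ of the identity $e$ there are neighborhoods $W\subseteq V\subseteq U$ of $e$ such that $a\oplus(b\oplus V)=(a\oplus b)\oplus V$ for all $a,b\in W$. No separation axiom is assumed unless stated. A space $X$ is regular if for every $x\in X$ and every open $U\ni x$ there is a neighborhood $V$ of $x$ with $\overline{V}\subseteq U$. A space $X$ is completely regular if for every $x\in X$ and every open $U\ni x$ there is a continuous $f:X\to[0,1]$ with $f(x)=0$ and $f^{-1}([0,1))\subseteq U$. A space $X$ is functionally Hausdorff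 if for any distinct $x,y\in X$ there is a continuous function $f:X\to\mathbb{R}$ with $f(x)\neq f(y)$. *)

theory Defs
  imports "HOL-Analysis.Analysis"
begin

text \<open>
  The identity and the gyrations are parameters rather than existentially bound; a theorem
  about all \<open>gyrogroup G (\<oplus>) e gyr\<close> thus covers every pair \<open>(G, \<oplus>)\<close> for which suitable \<open>e\<close> and
  \<open>gyr\<close> exist. Values of \<open>(\<oplus>)\<close> and \<open>gyr\<close> outside \<open>G\<close> are unconstrained, so the equality of
  gyrations in the last axiom is an equality of maps on \<open>G\<close>.
\<close>

locale gyrogroup =
  fixes G :: "'a set"
    and gplus :: "'a \<Rightarrow> 'a \<Rightarrow> 'a"  (infixl \<open>\<oplus>\<close> 65)
    and e :: 'a
    and gyr :: "'a \<Rightarrow> 'a \<Rightarrow> 'a \<Rightarrow> 'a"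
  assumes closed: "\<lbrakk>x \<in> G; y \<in> G\<rbrakk> \<Longrightarrow> x \<oplus> y \<in> G"
    and e_in: "e \<in> G"
    and e_left: "x \<in> G \<Longrightarrow> e \<oplus> x = x"
    and e_right: "x \<in> G \<Longrightarrow> x \<oplus> e = x"
    and inverse_ex: "x \<in> G \<Longrightarrow> \<exists>x'\<in>G. x' \<oplus> x = e \<and> x \<oplus> x' = e"
    and gyr_bij: "\<lbrakk>x \<in> G; y \<in> G\<rbrakk> \<Longrightarrow> bij_betw (gyr x y) G G"
    and gyr_hom: "\<lbrakk>x \<in> G; y \<in> G; a \<in> G; b \<in> G\<rbrakk> \<Longrightarrow> gyr x y (a \<oplus> b) = gyr x y a \<oplus> gyr x y b"
    and gyr_assoc: "\<lbrakk>x \<in> G; y \<in> G; z \<in> G\<rbrakk> \<Longrightarrow> x \<oplus> (y \<oplus> z) = (x \<oplus> y) \<oplus> gyr x y z"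
    and gyr_loop: "\<lbrakk>x \<in> G; y \<in> G; z \<in> G\<rbrakk> \<Longrightarrow> gyr (x \<oplus> y) y z = gyr x y z"

locale paratopological_gyrogroup =
  gyrogroup "topspace X" gplus e gyr
  for X :: "'a topology"
    and gplus :: "'a \<Rightarrow> 'a \<Rightarrow> 'a"  (infixl \<open>\<oplus>\<close> 65)
    and e :: 'a
    and gyr :: "'a \<Rightarrow> 'a \<Rightarrow> 'a \<Rightarrow> 'a" +
  assumes continuous_gplus: "continuous_map (prod_topology X X) X (\<lambda>(x, y). x \<oplus> y)"

text \<open>Neighbourhoods need not be open.\<close>

definition neighbourhood_in :: "'a topology \<Rightarrow> 'a \<Rightarrow> 'a set \<Rightarrow> bool" where
  "neighbourhood_in X x N \<longleftrightarrow> N \<subseteq> topspace X \<and> (\<exists>T. openin X T \<and> x \<in> T \<and> T \<subseteq> N)"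

definition left_translate :: "('a \<Rightarrow> 'a \<Rightarrow> 'a) \<Rightarrow> 'a \<Rightarrow> 'a set \<Rightarrow> 'a set" where
  "left_translate gplus x A = {gplus x a |a. a \<in> A}"

locale micro_associative_paratopological_gyrogroup =
  paratopological_gyrogroup X gplus e gyr
  for X :: "'a topology"
    and gplus :: "'a \<Rightarrow> 'a \<Rightarrow> 'a"  (infixl \<open>\<oplus>\<close> 65)
    and e :: 'a
    and gyr :: "'a \<Rightarrow> 'a \<Rightarrow> 'a \<Rightarrow> 'a" +
  assumes micro_associative:
    "neighbourhood_in X e U \<Longrightarrow>
      \<exists>V W. neighbourhood_in X e V \<and> neighbourhood_in X e W \<and> W \<subseteq> V \<and> V \<subseteq> U \<and>
        (\<forall>a\<in>W. \<forall>b\<in>W. left_translate (\<oplus>) a (left_translate (\<oplus>) b V)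
                        = left_translate (\<oplus>) (a \<oplus> b) V)"

definition functionally_Hausdorff_space :: "'a topology \<Rightarrow> bool" where
  "functionally_Hausdorff_space X \<longleftrightarrow>
    (\<forall>x\<in>topspace X. \<forall>y\<in>topspace X. x \<noteq> y \<longrightarrow>
      (\<exists>f. continuous_map X euclideanreal f \<and> f x \<noteq> f y))"

text \<open>
  The library's \<^const>\<open>regular_space\<close> and \<^const>\<open>completely_regular_space\<close> include no
  separation axiom; the next two lemmas give their formulations in terms of neighbourhoods.
\<close>

lemma regular_space_iff_closed_neighbourhood:
  "regular_space X \<longleftrightarrow>
    (\<forall>x\<in>topspace X. \<forall>U. openin X U \<and> x \<in> U \<longrightarrow>
      (\<exists>V. neighbourhood_in X x V \<and> X closure_of V \<subseteq> U))"
proof -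
  have "(\<exists>T V. openin X T \<and> closedin X V \<and> x \<in> T \<and> T \<subseteq> V \<and> V \<subseteq> U) \<longleftrightarrow>
      (\<exists>V. neighbourhood_in X x V \<and> X closure_of V \<subseteq> U)" (is "?L \<longleftrightarrow> ?R") for x U
  proof
    assume ?L
    then obtain T V where "openin X T" "closedin X V" "x \<in> T" "T \<subseteq> V" "V \<subseteq> U" by blast
    then have "neighbourhood_in X x V" "X closure_of V \<subseteq> U"
      by (auto simp: neighbourhood_in_def closure_of_closedin dest: closedin_subset)
    then show ?R by blast
  next
    assume ?R
    then obtain V T where "V \<subseteq> topspace X" "openin X T" "x \<in> T" "T \<subseteq> V" "X closure_of V \<subseteq> U"
      by (auto simp: neighbourhood_in_def)
    then show ?L
      by (metis closedin_closure_of closure_of_subset order.trans)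
  qed
  then show ?thesis
    unfolding neighbourhood_base_of_closedin [symmetric] neighbourhood_base_of_def
      neighbourhood_base_at_def by simp
qed

lemma completely_regular_space_iff_preimage:
  "completely_regular_space X \<longleftrightarrow>
    (\<forall>x\<in>topspace X. \<forall>U. openin X U \<and> x \<in> U \<longrightarrow>
      (\<exists>f. continuous_map X (top_of_set {0..1::real}) f \<and> f x = 0 \<and>
           {y \<in> topspace X. f y \<in> {0..<1}} \<subseteq> U))"
proof -
  have "f ` (topspace X - U) \<subseteq> {1} \<longleftrightarrow> {y \<in> topspace X. f y \<in> {0..<1}} \<subseteq> U"
    if "continuous_map X (top_of_set {0..1::real}) f" for f U
  proof -
    have "f y \<in> {0..1}" if "y \<in> topspace X" for y
      using \<open>continuous_map X (top_of_set {0..1::real}) f\<close> that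
      by (auto simp: continuous_map_in_subtopology)
    then show ?thesis
      by (fastforce simp: less_le)
  qed
  then have *: "(\<exists>f. continuous_map X (top_of_set {0..1::real}) f \<and> f x = 0 \<and>
           {y \<in> topspace X. f y \<in> {0..<1}} \<subseteq> U) \<longleftrightarrow>
      (\<exists>f. continuous_map X (top_of_set {0..1::real}) f \<and> f x = 0 \<and>
           f ` (topspace X - U) \<subseteq> {1})" for x U
    by blast
  show ?thesis
    unfolding completely_regular_space_def *
  proof (intro iffI allI ballI impI; elim conjE)
    fix x U
    assume "\<forall>S x. closedin X S \<and> x \<in> topspace X - S \<longrightarrow>
        (\<exists>f. continuous_map X (top_of_set {0..1::real}) f \<and> f x = 0 \<and> f ` S \<subseteq> {1})"
      and "x \<in> topspace X" "openin X U" "x \<in> U"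
    then show "\<exists>f. continuous_map X (top_of_set {0..1::real}) f \<and> f x = 0 \<and>
        f ` (topspace X - U) \<subseteq> {1}"
      by blast
  next
    fix S x
    assume H: "\<forall>x\<in>topspace X. \<forall>U. openin X U \<and> x \<in> U \<longrightarrow>
        (\<exists>f. continuous_map X (top_of_set {0..1::real}) f \<and> f x = 0 \<and>
             f ` (topspace X - U) \<subseteq> {1})"
      and S: "closedin X S" "x \<in> topspace X - S"
    have "topspace X - (topspace X - S) = S"
      using closedin_subset [OF S(1)] by blast
    moreover have "openin X (topspace X - S)"
      using S(1) by blast
    ultimately show "\<exists>f. continuous_map X (top_of_set {0..1::real}) f \<and> f x = 0 \<and> f ` S \<subseteq> {1}"
      using H S(2) by (metis DiffD1)
  qed
qed

end

(*
  Micro-associativity provides arbitrarily small neighbourhoods V of e that are invariant under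
  gyr a b for all a, b close to e. If A is invariant in this sense, then
  a + (b + A) = (a + b) + A for small a, b, so the relation "W + A <= B for some neighbourhood W
  of e" interpolates, and {e} can be separated from the complement of a given neighbourhood by
  a dyadic chain of sets.

  As in the Banakh-Ravsky theorem on paratopological groups, W + A <= B yields cl A <= int (cl B):
  left translations are continuous, so W + cl A <= cl B, and W + x is a neighbourhood of x
  because right translations are homeomorphisms. Hence the closures of the sets in the chain are
  the sublevel sets of a Urysohn function at e, which left translations move to any other point.
*)

theory Submission
  imports Defs
begin

section \<open>Urysohn functions from dyadic chains of sets\<close>

lemma dyadics_dense_unit_interval:
  fixes a b :: real
  assumes "0 \<le> a" "a < b" "b \<le> 1"
  obtains r where "r \<in> dyadics \<inter> {0..1}" "a < r" "r < b"
proof -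
  obtain n q r where "of_nat q / 2^n \<le> a" "a < of_nat r / 2^n"
    "\<bar>of_nat q / 2^n - of_nat r / (2::real)^n\<bar> < b - a"
    by (rule padic_rational_approximation_straddle_pos_le [of "b - a" 2 a]) (use assms in auto)
  then have "a < of_nat r / 2^n" "of_nat r / 2^n < b"
    by linarith+
  moreover from this have "of_nat r / 2^n \<in> dyadics \<inter> {0..1::real}"
    using assms unfolding dyadics_def Int_iff atLeastAtMost_iff by (intro conjI) (blast, linarith+)
  ultimately show thesis
    using that by blast
qed

text \<open>
  A version of Urysohn's lemma for a relation that satisfies only \<open>cl A \<subseteq> int (cl B)\<close>
  instead of \<open>cl A \<subseteq> int B\<close>.
\<close>

lemma Urysohn_closure_interior:
  fixes R :: "'a set \<Rightarrow> 'a set \<Rightarrow> bool"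
  assumes AB: "R A B"
    and interpolation: "\<And>A B. R A B \<Longrightarrow> \<exists>C. R A C \<and> R C B"
    and trans: "\<And>A B C. \<lbrakk>R A B; R B C\<rbrakk> \<Longrightarrow> R A C"
    and normal: "\<And>A B. R A B \<Longrightarrow> X closure_of A \<subseteq> X interior_of (X closure_of B)"
  obtains f where "continuous_map X (top_of_set {0..1::real}) f"
    "f ` (X closure_of A) \<subseteq> {0}" "f ` (topspace X - X closure_of B) \<subseteq> {1}"
proof -
  define D where "D = (dyadics \<inter> {0..1} :: real set)"
  have "\<exists>F :: real \<Rightarrow> 'a set. F 0 = A \<and> F 1 = B \<and>
      (\<forall>x \<in> dyadics \<inter> {0..1}. \<forall>y \<in> dyadics \<inter> {0..1}. x < y \<longrightarrow> R (F x) (F y))"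
    by (rule recursion_on_dyadic_fractions) (use AB interpolation trans in blast)+
  then obtain F where F0: "F 0 = A" and F1: "F 1 = B"
    and F: "\<And>r s. \<lbrakk>r \<in> D; s \<in> D; r < s\<rbrakk> \<Longrightarrow> R (F r) (F s)"
    unfolding D_def by blast
  have D: "0 \<in> D" "1 \<in> D" "\<And>r. r \<in> D \<Longrightarrow> 0 \<le> r \<and> r \<le> 1"
    unfolding D_def by (force simp: dyadics_def)+
  have dense: "\<exists>r\<in>D. a < r \<and> r < b" if "0 \<le> a" "a < b" "b \<le> 1" for a b
    using dyadics_dense_unit_interval [OF that] unfolding D_def by blast
  have normal_F: "X closure_of F r \<subseteq> X interior_of (X closure_of F s)"
    if "r \<in> D" "s \<in> D" "r < s" for r s
    using F [OF that] by (rule normal)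
  have mono_F: "X closure_of F r \<subseteq> X closure_of F s" if "r \<in> D" "s \<in> D" "r < s" for r s
    using normal_F [OF that] interior_of_subset by (rule order_trans)
  \<comment> \<open>Inserting 1 keeps \<open>S x\<close> nonempty and gives \<open>f\<close> the
    value 1 outside all closures of the chain.\<close>
  define S where "S x = insert 1 {r \<in> D. x \<in> X closure_of F r}" for x
  define f where "f x = Inf (S x)" for x
  have S: "S x \<noteq> {}" "bdd_below (S x)" for x
    using D by (auto simp: S_def intro: bdd_belowI [of _ 0])
  have f_less: "f x < b \<longleftrightarrow> (\<exists>r\<in>S x. r < b)" for x b
    unfolding f_def by (rule cInf_less_iff [OF S])
  have f_le: "f x \<le> r" if "r \<in> S x" for x r
    unfolding f_def using S(2) that by (simp add: cInf_lower)
  have f_ge: "r \<le> f x" if "\<And>s. s \<in> S x \<Longrightarrow> r \<le> s" for x r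
    unfolding f_def using S(1) that by (rule cInf_greatest)
  have f_01: "0 \<le> f x" "f x \<le> 1" for x
    using D by (auto intro!: f_ge f_le simp: S_def)
  \<comment> \<open>Closures grow along the chain, so a point outside the closure of
    \<open>F s\<close> lies outside every earlier one.\<close>
  have f_ge_notin: "s \<le> f x" if "s \<in> D" "x \<notin> X closure_of F s" for x s
    using mono_F that D by (intro f_ge) (force simp: S_def not_le [symmetric])
  have "openin X {x \<in> topspace X. f x < b}" for b
  \<comment> \<open>For b \<le> 1 the inserted element 1 cannot witness \<open>f x < b\<close>, so
    the witness is an index of the chain.\<close>
  proof (cases "b > 1")
    case True
    then have "{x \<in> topspace X. f x < b} = topspace X"
      using f_01 order_le_less_trans by blast
    then show ?thesis by simp
  next
    case False
    have "{x \<in> topspace X. f x < b} = (\<Union>s\<in>{s\<in>D. s < b}. X interior_of (X closure_of F s))"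
      (is "?L = ?R")
    proof
      show "?L \<subseteq> ?R"
      proof
        fix x assume "x \<in> ?L"
        then obtain r where r: "r \<in> D" "x \<in> X closure_of F r" "r < b"
          using False by (auto simp: f_less S_def)
        \<comment> \<open>A second index strictly between \<open>r\<close> and \<open>b\<close>
          turns membership in a closure into membership in an interior.\<close>
        then obtain s where "s \<in> D" "r < s" "s < b"
          using dense [of r b] D False by force
        then show "x \<in> ?R"
          using normal_F [of r s] r by blast
      qed
      show "?R \<subseteq> ?L"
        using interior_of_subset interior_of_subset_topspace
        by (fastforce simp: f_less S_def)
    qed
    then show ?thesis by auto
  qed
  moreover have "openin X {x \<in> topspace X. a < f x}" for a
  proof (cases "a < 0")
    case True
    then have "{x \<in> topspace X. a < f x} = topspace X"
      using f_01 order_less_le_trans by blast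
    then show ?thesis by simp
  next
    case False
    have "{x \<in> topspace X. a < f x} = (\<Union>s\<in>{s\<in>D. a < s}. topspace X - X closure_of F s)"
      (is "?L = ?R")
    proof
      show "?L \<subseteq> ?R"
      proof
        fix x assume x: "x \<in> ?L"
        then obtain s where "s \<in> D" "a < s" "s < f x"
          using dense [of a "f x"] f_01 False by force
        then show "x \<in> ?R"
          using x f_le [of s x] by (force simp: S_def)
      qed
      show "?R \<subseteq> ?L"
        using f_ge_notin by force
    qed
    also have "openin X \<dots>"
      by (rule openin_Union) auto
    finally show ?thesis .
  qed
  ultimately have "continuous_map X euclideanreal f"
    by (simp add: continuous_map_upper_lower_semicontinuous_lt)
  then have "continuous_map X (top_of_set {0..1}) f"
    using f_01 by (auto simp: continuous_map_in_subtopology)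
  moreover have "f ` (X closure_of A) \<subseteq> {0}"
    using f_le [of 0] f_01 D F0 by (force simp: S_def intro: antisym)
  moreover have "f ` (topspace X - X closure_of B) \<subseteq> {1}"
    using f_ge_notin [of 1] f_01 D F1 by (force intro: antisym)
  ultimately show thesis
    by (rule that)
qed

section \<open>Gyrogroup algebra: cancellation, the left Bol identity and right translations\<close>

context gyrogroup
begin

definition gminus :: "'a \<Rightarrow> 'a"  (\<open>\<ominus> _\<close> [81] 80)
  where "\<ominus> x = (SOME x'. x' \<in> G \<and> x' \<oplus> x = e \<and> x \<oplus> x' = e)"

lemma gminus:
  assumes "x \<in> G"
  shows gminus_closed: "\<ominus> x \<in> G" and gminus_left: "\<ominus> x \<oplus> x = e"
    and gminus_right: "x \<oplus> \<ominus> x = e"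
  using someI_ex [OF inverse_ex [OF assms, unfolded Bex_def]] by (simp_all add: gminus_def)

lemma gyr_closed: "\<lbrakk>x \<in> G; y \<in> G; z \<in> G\<rbrakk> \<Longrightarrow> gyr x y z \<in> G"
  using gyr_bij bij_betwE by blast

text \<open>Adding \<open>\<ominus> x\<close> on the left and reassociating reduces the claim to
  injectivity of \<open>gyr (\<ominus> x) x\<close>.\<close>

lemma left_cancel:
  assumes "x \<in> G" "y \<in> G" "z \<in> G" "x \<oplus> y = x \<oplus> z"
  shows "y = z"
proof -
  have "e \<oplus> gyr (\<ominus> x) x y = e \<oplus> gyr (\<ominus> x) x z"
    using assms gyr_assoc [of "\<ominus> x" x y] gyr_assoc [of "\<ominus> x" x z] by (simp add: gminus)
  then have "gyr (\<ominus> x) x y = gyr (\<ominus> x) x z"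
    using assms by (simp add: e_left gyr_closed gminus)
  moreover have "inj_on (gyr (\<ominus> x) x) G"
    using gyr_bij [of "\<ominus> x" x] assms by (simp add: bij_betw_def gminus)
  ultimately show ?thesis
    using assms by (simp add: inj_on_eq_iff)
qed

lemma gyr_e_left:
  assumes "x \<in> G" "z \<in> G"
  shows "gyr e x z = z"
  using gyr_assoc [of e x z] assms
  by (metis closed e_in e_left gyr_closed left_cancel)

text \<open>The loop axiom identifies \<open>gyr (\<ominus> x) x\<close> with
  \<open>gyr e x\<close>, which is trivial.\<close>

lemma gminus_gplus_cancel:
  assumes "x \<in> G" "z \<in> G"
  shows "\<ominus> x \<oplus> (x \<oplus> z) = z"
proof -
  have "gyr (\<ominus> x) x z = z"
    using gyr_loop [of "\<ominus> x" x z] gyr_e_left assms by (simp add: gminus)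
  then show ?thesis
    using gyr_assoc [of "\<ominus> x" x z] assms by (simp add: gminus e_left)
qed

lemma gplus_gminus_cancel:
  assumes "x \<in> G" "z \<in> G"
  shows "x \<oplus> (\<ominus> x \<oplus> z) = z"
  using assms by (metis closed gminus_closed gminus_gplus_cancel left_cancel)

text \<open>Expand \<open>\<ominus> q \<oplus> (q \<oplus> (p \<oplus> w))\<close> in two ways and
  cancel \<open>p\<close>. The loop axiom replaces the index \<open>\<ominus> q\<close> by
  \<open>\<ominus> q \<oplus> (q \<oplus> p) = p\<close>.\<close>

lemma gyr_gplus_inverse:
  assumes "p \<in> G" "q \<in> G" "w \<in> G"
  shows "gyr p (q \<oplus> p) (gyr q p w) = w"
proof -
  have G: "q \<oplus> p \<in> G" "\<ominus> q \<in> G" "gyr q p w \<in> G"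
    using assms by (simp_all add: closed gminus_closed gyr_closed)
  have "p \<oplus> w = \<ominus> q \<oplus> ((q \<oplus> p) \<oplus> gyr q p w)"
    using assms by (metis closed gminus_gplus_cancel gyr_assoc)
  also have "\<dots> = p \<oplus> gyr (\<ominus> q) (q \<oplus> p) (gyr q p w)"
    using gyr_assoc [of "\<ominus> q" "q \<oplus> p" "gyr q p w"] assms G by (simp add: gminus_gplus_cancel)
  also have "gyr (\<ominus> q) (q \<oplus> p) (gyr q p w) = gyr p (q \<oplus> p) (gyr q p w)"
    using gyr_loop [of "\<ominus> q" "q \<oplus> p" "gyr q p w"] assms G by (simp add: gminus_gplus_cancel)
  finally show ?thesis
    using assms G by (metis gyr_closed left_cancel)
qed

text \<open>Reassociating the right-hand side twice produces two gyrations, and these are inverse to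
  each other.\<close>

lemma left_Bol:
  assumes "p \<in> G" "q \<in> G" "c \<in> G"
  shows "(p \<oplus> (q \<oplus> p)) \<oplus> c = p \<oplus> (q \<oplus> (p \<oplus> c))"
  using assms by (simp add: gyr_assoc closed gyr_closed gyr_gplus_inverse)

text \<open>
  The left Bol identity expresses the inverse of a right translation through left
  translations and another right translation. Hence right translations are homeomorphisms
  even where \<open>\<ominus>\<close> is not continuous.
\<close>

lemma right_translation_inverse:
  assumes "x \<in> G" "a \<in> G"
  shows "(\<ominus> x \<oplus> ((x \<oplus> a) \<oplus> \<ominus> x)) \<oplus> x = a"
  \<comment> \<open>The Bol identity is applied with \<open>p = \<ominus> x\<close>,
    \<open>q = x \<oplus> a\<close> and \<open>c = x\<close>.\<close>
  using assms by (simp add: left_Bol closed gminus e_right gminus_gplus_cancel)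

text \<open>The loop axiom makes \<open>gyr x x\<close> trivial, so
  \<open>(x \<oplus> x) \<oplus> \<ominus> x\<close> reassociates to \<open>x\<close>.\<close>

lemma right_translation_inverse_self:
  assumes "x \<in> G"
  shows "\<ominus> x \<oplus> ((x \<oplus> x) \<oplus> \<ominus> x) = e"
proof -
  have "x \<oplus> (x \<oplus> \<ominus> x) = (x \<oplus> x) \<oplus> \<ominus> x"
    using assms gyr_loop [of e x "\<ominus> x"] gyr_e_left [of x "\<ominus> x"] gyr_assoc [of x x "\<ominus> x"]
    by (simp add: e_in e_left gminus)
  then show ?thesis
    using assms by (metis gminus_right gminus_left e_right)
qed

end

section \<open>Translations, neighbourhoods and closures\<close>

context paratopological_gyrogroup
begin

notation gminus  (\<open>\<ominus> _\<close> [81] 80)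

lemma continuous_map_gplus:
  assumes "continuous_map Y X f" "continuous_map Y X g"
  shows "continuous_map Y X (\<lambda>y. f y \<oplus> g y)"
  using continuous_map_compose [OF _ continuous_gplus, of Y "\<lambda>y. (f y, g y)"] assms
  by (simp add: continuous_map_pairwise o_def)

lemma continuous_map_left_translation:
  "x \<in> topspace X \<Longrightarrow> continuous_map X X ((\<oplus>) x)"
  using continuous_map_gplus [of X "\<lambda>y. x" "\<lambda>y. y"] by simp

definition set_plus :: "'a set \<Rightarrow> 'a set \<Rightarrow> 'a set"  (infixl \<open>\<Oplus>\<close> 65)
  where "A \<Oplus> B = {a \<oplus> b |a b. a \<in> A \<and> b \<in> B}"

lemma set_plus_subset: "\<lbrakk>A \<subseteq> topspace X; B \<subseteq> topspace X\<rbrakk> \<Longrightarrow> A \<Oplus> B \<subseteq> topspace X"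
  by (auto simp: set_plus_def intro: closed)

lemma set_plus_mono: "\<lbrakk>A \<subseteq> A'; B \<subseteq> B'\<rbrakk> \<Longrightarrow> A \<Oplus> B \<subseteq> A' \<Oplus> B'"
  unfolding set_plus_def by blast

lemma subset_set_plus:
  assumes "e \<in> W" "A \<subseteq> topspace X"
  shows "A \<subseteq> W \<Oplus> A"
  using assms by (force simp: set_plus_def e_left intro: exI [of _ e])

lemma neighbourhood_right_translate:
  assumes W: "openin X W" "e \<in> W" and x: "x \<in> topspace X"
  shows "\<exists>T. openin X T \<and> x \<in> T \<and> T \<subseteq> W \<Oplus> {x}"
proof -
  \<comment> \<open>\<open>h\<close> undoes right translation by \<open>x\<close>. It is continuous
    because \<open>\<ominus> x\<close> enters only as a constant.\<close>
  define h where "h y = \<ominus> x \<oplus> ((x \<oplus> y) \<oplus> \<ominus> x)" for y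
  have "continuous_map X X h"
    unfolding h_def using x by (intro continuous_map_gplus) (simp_all add: gminus_closed)
  then have "openin X {y \<in> topspace X. h y \<in> W}"
    using W by (simp add: openin_continuous_map_preimage)
  moreover have "h x \<in> W"
    using x W by (simp add: h_def right_translation_inverse_self)
  moreover have "{y \<in> topspace X. h y \<in> W} \<subseteq> W \<Oplus> {x}"
  proof
    fix y assume "y \<in> {y \<in> topspace X. h y \<in> W}"
    then have "y = h y \<oplus> x" "h y \<in> W"
      using x by (simp_all add: h_def right_translation_inverse)
    then show "y \<in> W \<Oplus> {x}"
      unfolding set_plus_def by blast
  qed
  ultimately show ?thesis
    using x by blast
qed

lemma closure_of_set_plus_left:
  assumes "W \<subseteq> topspace X"
  shows "W \<Oplus> X closure_of A \<subseteq> X closure_of (W \<Oplus> A)"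
proof -
  have "w \<oplus> x \<in> X closure_of (W \<Oplus> A)" if "w \<in> W" "x \<in> X closure_of A" for w x
  proof -
    have "w \<oplus> x \<in> X closure_of ((\<oplus>) w ` A)"
      using continuous_map_image_closure_subset [OF continuous_map_left_translation, of w A]
        that assms by blast
    moreover have "(\<oplus>) w ` A \<subseteq> W \<Oplus> A"
      using that by (auto simp: set_plus_def)
    ultimately show ?thesis
      using closure_of_mono by blast
  qed
  then show ?thesis
    by (auto simp: set_plus_def)
qed

text \<open>Supplies the hypothesis \<open>normal\<close> of
  \<open>Urysohn_closure_interior\<close>.\<close>

lemma closure_of_subset_interior_of_closure_of:
  assumes W: "openin X W" "e \<in> W" and B: "W \<Oplus> A \<subseteq> B"
  shows "X closure_of A \<subseteq> X interior_of (X closure_of B)"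
proof
  fix x assume x: "x \<in> X closure_of A"
  then have "x \<in> topspace X"
    by (simp add: in_closure_of)
  then obtain T where T: "openin X T" "x \<in> T" "T \<subseteq> W \<Oplus> {x}"
    using neighbourhood_right_translate W by blast
  have "W \<Oplus> {x} \<subseteq> W \<Oplus> X closure_of A"
    using x by (intro set_plus_mono) auto
  also have "\<dots> \<subseteq> X closure_of (W \<Oplus> A)"
    using W openin_subset by (intro closure_of_set_plus_left) blast
  also have "\<dots> \<subseteq> X closure_of B"
    using B by (rule closure_of_mono)
  finally show "x \<in> X interior_of (X closure_of B)"
    using T unfolding interior_of_def by blast
qed

section \<open>Sets invariant under small gyrations, and strong containment\<close>

definition gyr_invariant :: "'a set \<Rightarrow> bool" where
  "gyr_invariant A \<longleftrightarrow> A \<subseteq> topspace X \<and>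
    (\<exists>W. openin X W \<and> e \<in> W \<and> (\<forall>a\<in>W. \<forall>b\<in>W. gyr a b ` A = A))"

lemma gyr_invariantE:
  assumes "gyr_invariant A"
  obtains W where "openin X W" "e \<in> W" "\<forall>a\<in>W. \<forall>b\<in>W. gyr a b ` A = A"
  using assms unfolding gyr_invariant_def by (elim conjE exE) simp

lemma gyr_invariant_subset: "gyr_invariant A \<Longrightarrow> A \<subseteq> topspace X"
  by (simp add: gyr_invariant_def)

text \<open>The sets are enlarged on the left because gyrations act on the right-hand summand.\<close>

definition strongly_contained :: "'a set \<Rightarrow> 'a set \<Rightarrow> bool"  (infix \<open>\<lless>\<close> 50) where
  "A \<lless> B \<longleftrightarrow> gyr_invariant A \<and> gyr_invariant B \<and> (\<exists>W. openin X W \<and> e \<in> W \<and> W \<Oplus> A \<subseteq> B)"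

text \<open>No reassociation occurs: \<open>B \<subseteq> W' \<Oplus> B \<subseteq> C\<close>
  because \<open>e\<close> lies in \<open>W'\<close>.\<close>

lemma strongly_contained_trans:
  assumes "A \<lless> B" "B \<lless> C"
  shows "A \<lless> C"
proof -
  obtain W W' where W: "openin X W" "e \<in> W" "W \<Oplus> A \<subseteq> B"
    and W': "openin X W'" "e \<in> W'" "W' \<Oplus> B \<subseteq> C"
    using assms unfolding strongly_contained_def by blast
  have "B \<subseteq> topspace X"
    using assms unfolding strongly_contained_def by (simp add: gyr_invariant_subset)
  then have "W \<Oplus> A \<subseteq> C"
    using subset_set_plus [of W' B] W W' by blast
  then show ?thesis
    using assms W unfolding strongly_contained_def by blast
qed

lemma gyr_image_set_plus:
  assumes "a \<in> topspace X" "b \<in> topspace X" "A \<subseteq> topspace X" "B \<subseteq> topspace X"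
  shows "gyr a b ` (A \<Oplus> B) = gyr a b ` A \<Oplus> gyr a b ` B"
proof -
  have "gyr a b (x \<oplus> y) = gyr a b x \<oplus> gyr a b y" if "x \<in> A" "y \<in> B" for x y
    using that assms by (intro gyr_hom) auto
  then have "gyr a b ` (A \<Oplus> B) = {gyr a b x \<oplus> gyr a b y |x y. x \<in> A \<and> y \<in> B}"
    unfolding set_plus_def by (force simp: image_def)
  also have "\<dots> = gyr a b ` A \<Oplus> gyr a b ` B"
    unfolding set_plus_def by blast
  finally show ?thesis .
qed

text \<open>Needed to keep interpolating sets invariant. Gyrations preserve sums, and the
  intersection of the two index neighbourhoods serves both summands.\<close>

lemma gyr_invariant_set_plus:
  assumes "gyr_invariant A" "gyr_invariant B"
  shows "gyr_invariant (A \<Oplus> B)"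
proof -
  obtain W where W: "openin X W" "e \<in> W" "\<forall>a\<in>W. \<forall>b\<in>W. gyr a b ` A = A"
    using assms(1) by (rule gyr_invariantE)
  obtain W' where W': "openin X W'" "e \<in> W'" "\<forall>a\<in>W'. \<forall>b\<in>W'. gyr a b ` B = B"
    using assms(2) by (rule gyr_invariantE)
  have AB: "A \<subseteq> topspace X" "B \<subseteq> topspace X"
    using assms by (simp_all add: gyr_invariant_subset)
  have "gyr a b ` (A \<Oplus> B) = A \<Oplus> B" if "a \<in> W \<inter> W'" "b \<in> W \<inter> W'" for a b
  proof -
    have "a \<in> topspace X" "b \<in> topspace X"
      using that W(1) openin_subset by blast+
    then show ?thesis
      using that AB by (simp add: gyr_image_set_plus W(3) W'(3))
  qed
  moreover have "openin X (W \<inter> W')" "e \<in> W \<inter> W'"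
    using W W' by auto
  ultimately show ?thesis
    unfolding gyr_invariant_def
    by (intro conjI exI [of _ "W \<inter> W'"] set_plus_subset AB ballI)
qed

text \<open>Lets the chain start at \<open>{e}\<close>. A gyration maps \<open>e\<close> to an
  element equal to its own double, which cancellation forces to be \<open>e\<close>.\<close>

lemma gyr_invariant_e: "gyr_invariant {e}"
proof -
  have "gyr a b e = e" if "a \<in> topspace X" "b \<in> topspace X" for a b
    using gyr_hom [of a b e e] that
    by (metis closed e_in e_left e_right gyr_closed left_cancel)
  then show ?thesis
    unfolding gyr_invariant_def using e_in by (intro conjI exI [of _ "topspace X"]) auto
qed

lemma set_plus_open_base:
  assumes "openin X W" "e \<in> W"
  shows "\<exists>V. openin X V \<and> e \<in> V \<and> V \<Oplus> V \<subseteq> W"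
proof -
  have "openin (prod_topology X X) {p \<in> topspace (prod_topology X X). (case p of (x, y) \<Rightarrow> x \<oplus> y) \<in> W}"
    using continuous_gplus assms(1) by (rule openin_continuous_map_preimage)
  moreover have "(e, e) \<in> {p \<in> topspace (prod_topology X X). (case p of (x, y) \<Rightarrow> x \<oplus> y) \<in> W}"
    using assms e_in by (simp add: e_left)
  ultimately obtain U V where "openin X U" "openin X V" "e \<in> U" "e \<in> V"
    and UV: "U \<times> V \<subseteq> {p \<in> topspace (prod_topology X X). (case p of (x, y) \<Rightarrow> x \<oplus> y) \<in> W}"
    unfolding openin_prod_topology_alt by meson
  then have "openin X (U \<inter> V)" "e \<in> U \<inter> V" "(U \<inter> V) \<Oplus> (U \<inter> V) \<subseteq> W"
    by (auto simp: set_plus_def)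
  then show ?thesis by blast
qed

end

section \<open>Interpolation and separation under micro-associativity\<close>

context micro_associative_paratopological_gyrogroup
begin

lemma gyr_invariant_neighbourhood_base:
  assumes "openin X U" "e \<in> U"
  shows "\<exists>V T. gyr_invariant V \<and> V \<subseteq> U \<and> openin X T \<and> e \<in> T \<and> T \<subseteq> V"
proof -
  have "neighbourhood_in X e U"
    using assms openin_subset unfolding neighbourhood_in_def by blast
  then obtain V W where V: "neighbourhood_in X e V" "neighbourhood_in X e W" "V \<subseteq> U"
    and assoc: "\<And>a b. \<lbrakk>a \<in> W; b \<in> W\<rbrakk> \<Longrightarrow> left_translate (\<oplus>) a (left_translate (\<oplus>) b V)
                        = left_translate (\<oplus>) (a \<oplus> b) V"
    using micro_associative by metis
  have VX: "V \<subseteq> topspace X" and WX: "W \<subseteq> topspace X"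
    using V unfolding neighbourhood_in_def by blast+
  have "gyr a b ` V = V" if "a \<in> W" "b \<in> W" for a b
  proof -
    have ab: "a \<in> topspace X" "b \<in> topspace X" "a \<oplus> b \<in> topspace X"
      using that WX closed by auto
    have "(\<oplus>) (a \<oplus> b) ` (gyr a b ` V) = (\<lambda>v. a \<oplus> (b \<oplus> v)) ` V"
      unfolding image_image using ab VX by (intro image_cong) (auto simp: gyr_assoc)
    also have "\<dots> = left_translate (\<oplus>) a (left_translate (\<oplus>) b V)"
      by (auto simp: left_translate_def)
    also have "\<dots> = (\<oplus>) (a \<oplus> b) ` V"
      using assoc [OF that] by (auto simp: left_translate_def)
    finally have "(\<oplus>) (a \<oplus> b) ` (gyr a b ` V) = (\<oplus>) (a \<oplus> b) ` V" .
    moreover have "inj_on ((\<oplus>) (a \<oplus> b)) (topspace X)"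
      using ab left_cancel by (auto intro: inj_onI)
    moreover have "gyr a b ` V \<subseteq> topspace X"
      using ab VX gyr_closed by auto
    ultimately show ?thesis
      using VX by (simp add: inj_on_image_eq_iff)
  qed
  then show ?thesis
    using V VX unfolding gyr_invariant_def neighbourhood_in_def by (meson subsetD)
qed

text \<open>The interpolant is \<open>V \<Oplus> A\<close> for a small invariant neighbourhood
  \<open>V\<close> of \<open>e\<close>. Reassociating \<open>a \<oplus> (b \<oplus> c)\<close>
  leaves a gyration that \<open>A\<close> absorbs.\<close>

lemma strongly_contained_interpolation:
  assumes "A \<lless> B"
  shows "\<exists>C. A \<lless> C \<and> C \<lless> B"
proof -
  obtain W where W: "openin X W" "e \<in> W" "W \<Oplus> A \<subseteq> B"
    using assms unfolding strongly_contained_def by blast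
  have inv: "gyr_invariant A" "gyr_invariant B"
    using assms unfolding strongly_contained_def by auto
  obtain W' where W': "openin X W'" "e \<in> W'" "\<forall>a\<in>W'. \<forall>b\<in>W'. gyr a b ` A = A"
    using inv(1) by (rule gyr_invariantE)
  have AX: "A \<subseteq> topspace X"
    using inv(1) by (rule gyr_invariant_subset)
  obtain U where U: "openin X U" "e \<in> U" "U \<Oplus> U \<subseteq> W"
    using set_plus_open_base W by blast
  have "openin X (U \<inter> W')" "e \<in> U \<inter> W'"
    using U(1,2) W'(1,2) by auto
  \<comment> \<open>\<open>U\<close> keeps sums of two elements of \<open>V\<close> inside
    \<open>W\<close>; \<open>W'\<close> makes their gyrations preserve \<open>A\<close>.
    \<open>V\<close> may fail to be open, hence \<open>T\<close>.\<close>
  then obtain V T where V: "gyr_invariant V" "V \<subseteq> U \<inter> W'" and T: "openin X T" "e \<in> T" "T \<subseteq> V"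
    using gyr_invariant_neighbourhood_base by blast
  have "gyr_invariant (V \<Oplus> A)"
    using V inv by (simp add: gyr_invariant_set_plus)
  moreover have "T \<Oplus> A \<subseteq> V \<Oplus> A"
    using T by (simp add: set_plus_mono)
  moreover have "T \<Oplus> (V \<Oplus> A) \<subseteq> B"
  proof
    fix z assume "z \<in> T \<Oplus> (V \<Oplus> A)"
    then obtain a b c where z: "z = a \<oplus> (b \<oplus> c)" and abc: "a \<in> V" "b \<in> V" "c \<in> A"
      using T unfolding set_plus_def by blast
    have "z = (a \<oplus> b) \<oplus> gyr a b c"
      using abc z gyr_invariant_subset [OF V(1)] AX by (auto intro!: gyr_assoc)
    moreover have "gyr a b c \<in> A"
      using W'(3) abc V by blast
    moreover have "a \<oplus> b \<in> W"
      using abc V U unfolding set_plus_def by blast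
    ultimately show "z \<in> B"
      using W unfolding set_plus_def by blast
  qed
  ultimately show ?thesis
    using inv T unfolding strongly_contained_def by blast
qed

text \<open>The chain controls only closures, so the value 1 is obtained off the closure of
  \<open>U\<close>; regularity or the Hausdorff property later makes up for this.\<close>

lemma Urysohn_at_point:
  assumes U: "openin X U" "x \<in> U"
  obtains f where "continuous_map X (top_of_set {0..1::real}) f" "f x = 0"
    "f ` (topspace X - X closure_of U) \<subseteq> {1}"
proof -
  have x: "x \<in> topspace X"
    using U openin_subset by blast
  define U' where "U' = {y \<in> topspace X. x \<oplus> y \<in> U}"
  have "openin X U'" "e \<in> U'"
    unfolding U'_def using U x e_in
    by (simp_all add: openin_continuous_map_preimage [OF continuous_map_left_translation] e_right)
  then obtain V T where V: "gyr_invariant V" "V \<subseteq> U'" "openin X T" "e \<in> T" "T \<subseteq> V"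
    using gyr_invariant_neighbourhood_base by blast
  have "T \<Oplus> {e} \<subseteq> V"
    using V openin_subset by (fastforce simp: set_plus_def e_right)
  then have "{e} \<lless> V"
    using V gyr_invariant_e unfolding strongly_contained_def by blast
  then obtain f where f: "continuous_map X (top_of_set {0..1::real}) f"
    "f ` (X closure_of {e}) \<subseteq> {0}" "f ` (topspace X - X closure_of V) \<subseteq> {1}"
    using strongly_contained_interpolation strongly_contained_trans
  proof (rule Urysohn_closure_interior)
    show "X closure_of A \<subseteq> X interior_of (X closure_of B)" if "A \<lless> B" for A B
      using that closure_of_subset_interior_of_closure_of unfolding strongly_contained_def by blast
  qed
  show thesis
  proof
    show "continuous_map X (top_of_set {0..1}) (f \<circ> (\<oplus>) (\<ominus> x))"
      using x f(1) by (intro continuous_map_compose [where X' = X] continuous_map_left_translation)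
        (simp_all add: gminus_closed)
    have "e \<in> X closure_of {e}"
      using e_in closure_of_subset [of "{e}" X] by blast
    then show "(f \<circ> (\<oplus>) (\<ominus> x)) x = 0"
      using f x by (auto simp: gminus_left)
    \<comment> \<open>Left translation by \<open>x\<close> is continuous and maps \<open>V\<close>
      into \<open>U\<close>, hence the closure of \<open>V\<close> into that of
      \<open>U\<close>.\<close>
    have "\<ominus> x \<oplus> y \<in> topspace X - X closure_of V" if y: "y \<in> topspace X - X closure_of U" for y
    proof
      show "\<ominus> x \<oplus> y \<in> topspace X"
        using x y by (simp add: closed gminus_closed)
      show "\<ominus> x \<oplus> y \<notin> X closure_of V"
      proof
        assume "\<ominus> x \<oplus> y \<in> X closure_of V"
        then have "x \<oplus> (\<ominus> x \<oplus> y) \<in> X closure_of ((\<oplus>) x ` V)"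
          using continuous_map_image_closure_subset [OF continuous_map_left_translation [OF x]] by blast
        moreover have "(\<oplus>) x ` V \<subseteq> U"
          using V by (auto simp: U'_def)
        ultimately show False
          using y x closure_of_mono by (force simp: gplus_gminus_cancel)
      qed
    qed
    then show "(f \<circ> (\<oplus>) (\<ominus> x)) ` (topspace X - X closure_of U) \<subseteq> {1}"
      using f(3) by force
  qed
qed

text \<open>Regularity provides a neighbourhood of \<open>x\<close> whose closure misses
  \<open>S\<close>.\<close>

lemma regular_imp_completely_regular_space:
  assumes "regular_space X"
  shows "completely_regular_space X"
  unfolding completely_regular_space_def
proof (intro allI impI)
  fix S x assume "closedin X S \<and> x \<in> topspace X - S"
  then have S: "openin X (topspace X - S)" "x \<in> topspace X - S" "S \<subseteq> topspace X"
    using closedin_subset by auto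
  then obtain N where "neighbourhood_in X x N" and N: "X closure_of N \<subseteq> topspace X - S"
    using assms unfolding regular_space_iff_closed_neighbourhood by blast
  then obtain U where U: "openin X U" "x \<in> U" "U \<subseteq> N"
    unfolding neighbourhood_in_def by blast
  then obtain f where f: "continuous_map X (top_of_set {0..1::real}) f" "f x = 0"
    "f ` (topspace X - X closure_of U) \<subseteq> {1}"
    using Urysohn_at_point by blast
  have "S \<subseteq> topspace X - X closure_of U"
    using S(3) N closure_of_mono [OF U(3)] by blast
  then show "\<exists>f. continuous_map X (top_of_set {0..1::real}) f \<and> f x = 0 \<and> f ` S \<subseteq> {1}"
    using f by blast
qed

text \<open>Disjoint open neighbourhoods put \<open>y\<close> outside the closure of
  \<open>U\<close>.\<close>

lemma Hausdorff_imp_functionally_Hausdorff_space: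
  assumes "Hausdorff_space X"
  shows "functionally_Hausdorff_space X"
  unfolding functionally_Hausdorff_space_def
proof (intro ballI impI)
  fix x y assume xy: "x \<in> topspace X" "y \<in> topspace X" "x \<noteq> y"
  then obtain U V where "openin X U" "openin X V" "x \<in> U" "y \<in> V" "disjnt U V"
    using assms unfolding Hausdorff_space_def by metis
  then have "y \<notin> X closure_of U"
    by (auto simp: in_closure_of disjnt_iff)
  obtain f where f: "continuous_map X (top_of_set {0..1::real}) f" "f x = 0"
    "f ` (topspace X - X closure_of U) \<subseteq> {1}"
    using Urysohn_at_point \<open>openin X U\<close> \<open>x \<in> U\<close> by blast
  then have "f y = 1"
    using xy \<open>y \<notin> X closure_of U\<close> by blast
  then have "f x \<noteq> f y"
    using f by simp
  then show "\<exists>f. continuous_map X euclideanreal f \<and> f x \<noteq> f y"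
    using f(1) unfolding continuous_map_in_subtopology by blast
qed

end

theorem theorem3p5:
  fixes X :: "'a topology"
    and gplus :: "'a \<Rightarrow> 'a \<Rightarrow> 'a"
    and e :: 'a
    and gyr :: "'a \<Rightarrow> 'a \<Rightarrow> 'a \<Rightarrow> 'a"
  assumes "micro_associative_paratopological_gyrogroup X gplus e gyr"
  shows "(regular_space X \<longrightarrow> completely_regular_space X) \<and>
         (Hausdorff_space X \<longrightarrow> functionally_Hausdorff_space X)"
  using micro_associative_paratopological_gyrogroup.regular_imp_completely_regular_space [OF assms]
    micro_associative_paratopological_gyrogroup.Hausdorff_imp_functionally_Hausdorff_space [OF assms]
  by blast

end
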